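(* Let $S$ be a semigroup and let $X$ be a compact minimal $S$-system with its unique compatible uniform structure $\mu$. Let $(M,\xi)$ be a uniform space with a semigroup action of $S$ which is $\xi$-distal. Let $\alpha:X\to M$ be an $S$-map (not necessarily continuous) such that $X$ is $\xi$-nonsensitive with respect to $\alpha$. Then every pair $(x,y)$ in $X$ with $\alpha(x)\neq\alpha(y)$ is $\mu$-distal. In particular, if $\alpha$ is injective then the $S$-action on $(X,\mu)$ is distal.
   Context: An $S$-system is a topological space $X$ with an action of a (nonempty) semigroup $S$, $(st)x=s(tx)$, such that each translation $x\mapsto sx$ is continuous; compact spaces are Hausdorff. It is minimal if it is nonempty and has no proper nonempty closed $S$-invariant subset. An $S$-map satisfies $\alpha(sx)=s\alpha(x)$. For a uniform structure $\xi$ on a set with an $S$-action, a pair $(x,y)$ is $\xi$-distal if there is $\varepsilon\in\xi$ with $(sx,sy)\notin\varepsilon$ for all $s\in S$; the action is $\xi$-distal if every pair of distinct points is $\xi$-distal. A subset $B$ of $(M,\xi)$ is $\varepsilon$-small if $B\times B\subset\varepsilon$. $X$ is $\xi$-nonsensitive with respect to $\alpha:X\to M$ if for every $\varepsilon\in\xi$ there is a nonempty open $O\subset X$ such that $\alpha(O)$ is $\varepsilon$-small. (This holds for example if $X$ is $\xi$-fragmented by $\alpha$, i.e. if for every nonempty $A\subset X$ and $\varepsilon\in\xi$ there is an open $O\subset X$ with $O\cap A\neq\emptyset$ and $\alpha(O\cap A)$ $\varepsilon$-small.) *)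

theory Defs
  imports "HOL-Analysis.Analysis"
begin

text \<open>
  The semigroup, the spaces and the uniform structures are carried by types of the
  classes \<^class>\<open>semigroup_mult\<close>, \<^class>\<open>topological_space\<close> and
  \<^class>\<open>uniform_space\<close>.  Types are inhabited, so all of them are nonempty.
  Class \<^class>\<open>uniform_space\<close> does not include any separation axiom, and it
  requires \<^const>\<open>open\<close> to be the topology induced by \<^const>\<open>uniformity\<close>.
  Hence on a type of sort \<open>{t2_space, uniform_space}\<close> that is compact,
  \<^const>\<open>uniformity\<close> is the unique uniform structure compatible with the topology.
\<close>

definition semigroup_action :: "('s::semigroup_mult \<Rightarrow> 'x \<Rightarrow> 'x) \<Rightarrow> bool" where
  "semigroup_action act \<longleftrightarrow> (\<forall>s t x. act (s * t) x = act s (act t x))"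

definition S_system :: "('s::semigroup_mult \<Rightarrow> 'x::topological_space \<Rightarrow> 'x) \<Rightarrow> bool" where
  "S_system act \<longleftrightarrow> semigroup_action act \<and> (\<forall>s. continuous_on UNIV (act s))"

definition invariant_set :: "('s \<Rightarrow> 'x \<Rightarrow> 'x) \<Rightarrow> 'x set \<Rightarrow> bool" where
  "invariant_set act A \<longleftrightarrow> (\<forall>s. act s ` A \<subseteq> A)"

definition minimal_system :: "('s::semigroup_mult \<Rightarrow> 'x::topological_space \<Rightarrow> 'x) \<Rightarrow> bool" where
  "minimal_system act \<longleftrightarrow> S_system act \<and>
     \<not> (\<exists>A. A \<noteq> {} \<and> A \<noteq> UNIV \<and> closed A \<and> invariant_set act A)"

definition S_map :: "('s \<Rightarrow> 'x \<Rightarrow> 'x) \<Rightarrow> ('s \<Rightarrow> 'm \<Rightarrow> 'm) \<Rightarrow> ('x \<Rightarrow> 'm) \<Rightarrow> bool" where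
  "S_map actX actM \<alpha> \<longleftrightarrow> (\<forall>s x. \<alpha> (actX s x) = actM s (\<alpha> x))"

text \<open>Membership of a set of pairs in the uniform structure, which the library represents as a filter.\<close>

definition entourage :: "('m::uniform_space \<times> 'm) set \<Rightarrow> bool" where
  "entourage E \<longleftrightarrow> (\<forall>\<^sub>F p in uniformity. p \<in> E)"

definition distal_pair :: "('s \<Rightarrow> 'm::uniform_space \<Rightarrow> 'm) \<Rightarrow> 'm \<Rightarrow> 'm \<Rightarrow> bool" where
  "distal_pair act x y \<longleftrightarrow> (\<exists>E. entourage E \<and> (\<forall>s. (act s x, act s y) \<notin> E))"

definition distal_action :: "('s \<Rightarrow> 'm::uniform_space \<Rightarrow> 'm) \<Rightarrow> bool" where
  "distal_action act \<longleftrightarrow> (\<forall>x y. x \<noteq> y \<longrightarrow> distal_pair act x y)"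

definition small_set :: "('m \<times> 'm) set \<Rightarrow> 'm set \<Rightarrow> bool" where
  "small_set E B \<longleftrightarrow> B \<times> B \<subseteq> E"

definition nonsensitive :: "('x::topological_space \<Rightarrow> 'm::uniform_space) \<Rightarrow> bool" where
  "nonsensitive \<alpha> \<longleftrightarrow>
     (\<forall>E. entourage E \<longrightarrow> (\<exists>U. open U \<and> U \<noteq> {} \<and> small_set E (\<alpha> ` U)))"

end

theory Submission
  imports Defs
begin

text \<open>
  Minimality makes every orbit dense, so for a nonempty open set \<open>U\<close> the sets
  \<open>{z. s z \<in> U}\<close>, with \<open>s\<close> ranging over the semigroup, form an open cover of the compact
  space \<open>X\<close>.  A Lebesgue number of this cover is an entourage \<open>D\<close> such that any two
  \<open>D\<close>-close points are moved into \<open>U\<close> by a common semigroup element.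

  Let \<open>\<alpha> x \<noteq> \<alpha> y\<close>, let \<open>E\<close> be an entourage that witnesses the distality of
  \<open>(\<alpha> x, \<alpha> y)\<close>, and let \<open>U\<close> be a nonempty open set with \<open>E\<close>-small image, as
  nonsensitivity provides.  If \<open>s x\<close> and \<open>s y\<close> were \<open>D\<close>-close for some \<open>s\<close>, then
  \<open>t s x\<close> and \<open>t s y\<close> would lie in \<open>U\<close> for some \<open>t\<close>, and so \<open>(t s) (\<alpha> x)\<close> and
  \<open>(t s) (\<alpha> y)\<close> would be \<open>E\<close>-close.  Hence \<open>D\<close> itself witnesses that
  \<open>(x, y)\<close> is distal.  The map \<open>\<alpha>\<close> is controlled only on the single
  open set \<open>U\<close>, into which minimality brings every point.
\<close>

text \<open>
  The Lebesgue number lemma for uniform spaces.  If \<open>G\<close> is a cover member around \<open>z\<close>, halving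
  an entourage at \<open>z\<close> gives \<open>D\<close> such that every point \<open>D\<close>-close to a point of the
  \<open>D\<close>-neighbourhood of \<open>z\<close> is still in \<open>G\<close>.  Finitely many of these neighbourhoods cover the
  compact set, and the intersection of the finitely many entourages works for all of its points.
\<close>

lemma compact_Lebesgue_entourage:
  fixes K :: "'a::uniform_space set"
  assumes "compact K" and "\<And>z. z \<in> K \<Longrightarrow> \<exists>G\<in>\<C>. open G \<and> z \<in> G"
  shows "\<forall>\<^sub>F (u, v) in uniformity. u \<in> K \<longrightarrow> (\<exists>G\<in>\<C>. u \<in> G \<and> v \<in> G)"
proof -
  have "\<exists>N D. open N \<and> z \<in> N \<and> eventually D uniformity \<and>
      (\<forall>u v. u \<in> N \<longrightarrow> D (u, v) \<longrightarrow> (\<exists>G\<in>\<C>. u \<in> G \<and> v \<in> G))" if "z \<in> K" for z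
  proof -
    obtain G where G: "G \<in> \<C>" "open G" "z \<in> G"
      using assms(2) \<open>z \<in> K\<close> by blast
    then have "\<forall>\<^sub>F (z', v) in uniformity. z' = z \<longrightarrow> v \<in> G"
      unfolding open_uniformity by blast
    from uniformity_trans[OF this] obtain D where D: "eventually D uniformity"
      and D_G: "\<And>v w. D (z, v) \<Longrightarrow> D (v, w) \<Longrightarrow> w \<in> G"
      by auto
    have "\<forall>\<^sub>F u in nhds z. D (z, u)"
      unfolding eventually_nhds_uniformity
      using D by (rule eventually_mono) auto
    moreover have "\<forall>\<^sub>F u in nhds z. u \<in> G"
      using G by (simp add: eventually_nhds_in_open)
    ultimately have "\<forall>\<^sub>F u in nhds z. D (z, u) \<and> u \<in> G"
      by (rule eventually_conj)
    then obtain N where "open N" "z \<in> N" "\<forall>u\<in>N. D (z, u) \<and> u \<in> G"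
      unfolding eventually_nhds by blast
    with D D_G G(1) show ?thesis
      by blast
  qed
  then obtain N D where ND: "\<And>z. z \<in> K \<Longrightarrow> open (N z) \<and> z \<in> N z \<and> eventually (D z) uniformity \<and>
      (\<forall>u v. u \<in> N z \<longrightarrow> D z (u, v) \<longrightarrow> (\<exists>G\<in>\<C>. u \<in> G \<and> v \<in> G))"
    by metis
  obtain F where F: "F \<subseteq> K" "finite F" "K \<subseteq> (\<Union>z\<in>F. N z)"
    using compactE_image[OF assms(1), of K N] ND by blast
  have "\<forall>\<^sub>F p in uniformity. \<forall>z\<in>F. D z p"
    using F(1,2) ND by (intro eventually_ball_finite) auto
  then show ?thesis
  proof (rule eventually_mono, clarify)
    fix u v
    assume D: "\<forall>z\<in>F. D z (u, v)" and "u \<in> K"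
    then obtain z where z: "z \<in> F" "u \<in> N z"
      using F(3) by blast
    with F(1) have "z \<in> K"
      by blast
    from ND[OF this] z D show "\<exists>G\<in>\<C>. u \<in> G \<and> v \<in> G"
      by simp
  qed
qed

text \<open>
  The closure of the orbit of \<open>z\<close> is closed, invariant and nonempty, hence the whole space.
\<close>

lemma minimal_system_orbit_meets_open:
  fixes act :: "'s::semigroup_mult \<Rightarrow> 'x::topological_space \<Rightarrow> 'x"
  assumes "minimal_system act" and "open U" and "U \<noteq> {}"
  shows "\<exists>s. act s z \<in> U"
proof -
  have mult: "act (s * t) x = act s (act t x)" and cont: "continuous_on UNIV (act s)" for s t x
    using assms(1) by (auto simp: minimal_system_def S_system_def semigroup_action_def)
  let ?O = "range (\<lambda>s. act s z)"
  have "invariant_set act (closure ?O)"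
    unfolding invariant_set_def
  proof
    fix t
    have "act t ` ?O \<subseteq> ?O"
      by (auto simp flip: mult)
    then have "act t ` ?O \<subseteq> closure ?O"
      using closure_subset by blast
    then show "act t ` closure ?O \<subseteq> closure ?O"
      by (intro image_closure_subset) (auto intro: continuous_on_subset[OF cont])
  qed
  then have "closure ?O = UNIV"
    using assms(1) by (auto simp: minimal_system_def)
  then have "?O \<inter> U \<noteq> {}"
    using assms(2,3) open_Int_closure_eq_empty[of U ?O] by auto
  then show ?thesis
    by blast
qed

lemma compact_minimal_system_common_return:
  fixes act :: "'s::semigroup_mult \<Rightarrow> 'x::uniform_space \<Rightarrow> 'x"
  assumes "compact (UNIV :: 'x set)" and "minimal_system act" and "open U" and "U \<noteq> {}"
  shows "entourage {(u, v). \<exists>s. act s u \<in> U \<and> act s v \<in> U}"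
proof -
  have "open (act s -` U)" for s
    using assms(2,3) by (auto simp: minimal_system_def S_system_def intro: open_vimage)
  moreover have "\<exists>s. z \<in> act s -` U" for z
    using minimal_system_orbit_meets_open[OF assms(2-4)] by simp
  ultimately have "\<forall>\<^sub>F (u, v) in uniformity.
      u \<in> UNIV \<longrightarrow> (\<exists>G\<in>range (\<lambda>s. act s -` U). u \<in> G \<and> v \<in> G)"
    using compact_Lebesgue_entourage[OF assms(1), of "range (\<lambda>s. act s -` U)"] by simp
  then show ?thesis
    by (simp add: entourage_def case_prod_unfold)
qed

theorem lemma1p2:
  fixes actX :: "'s::semigroup_mult \<Rightarrow> 'x::{t2_space, uniform_space} \<Rightarrow> 'x"
    and actM :: "'s \<Rightarrow> 'm::uniform_space \<Rightarrow> 'm"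
    and \<alpha> :: "'x \<Rightarrow> 'm"
  assumes "compact (UNIV :: 'x set)"
    and "minimal_system actX"
    and "semigroup_action actM"
    and "distal_action actM"
    and "S_map actX actM \<alpha>"
    and "nonsensitive \<alpha>"
  shows "(\<forall>x y. \<alpha> x \<noteq> \<alpha> y \<longrightarrow> distal_pair actX x y) \<and>
         (inj \<alpha> \<longrightarrow> distal_action actX)"
proof -
  have distal: "distal_pair actX x y" if "\<alpha> x \<noteq> \<alpha> y" for x y
  proof -
    obtain E where E: "entourage E" "\<And>s. (actM s (\<alpha> x), actM s (\<alpha> y)) \<notin> E"
      using assms(4) \<open>\<alpha> x \<noteq> \<alpha> y\<close> unfolding distal_action_def distal_pair_def by blast
    obtain U where U: "open U" "U \<noteq> {}" "small_set E (\<alpha> ` U)"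
      using assms(6) E(1) unfolding nonsensitive_def by blast
    let ?D = "{(u, v). \<exists>t. actX t u \<in> U \<and> actX t v \<in> U}"
    have "(actX s x, actX s y) \<notin> ?D" for s
    proof
      assume "(actX s x, actX s y) \<in> ?D"
      then obtain t where t: "actX t (actX s x) \<in> U" "actX t (actX s y) \<in> U"
        by blast
      then have "(\<alpha> (actX t (actX s x)), \<alpha> (actX t (actX s y))) \<in> E"
        using U(3) unfolding small_set_def by blast
      then have "(actM (t * s) (\<alpha> x), actM (t * s) (\<alpha> y)) \<in> E"
        using assms(3,5) by (simp add: S_map_def semigroup_action_def)
      with E(2) show False
        by blast
    qed
    then show ?thesis
      using compact_minimal_system_common_return[OF assms(1,2) U(1,2)]
      unfolding distal_pair_def by blast
  qed
  then show ?thesis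
    by (auto simp: distal_action_def inj_def)
qed

end
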